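(* Let $k:\mathbb{R}^2\to[0,\infty)$ and $g:\mathbb{R}\to[0,\infty)$ satisfy the general conditions (GC), and suppose moreover that - (K3) the function $K(x)=\int_0^x k(x,s)\,ds$, $x\ge0$, is continuous; - (K4) $k(x,s)\le k(x+\lambda,s+\lambda)$ for every $(x,s)\in\mathbb{R}^2$ and every $\lambda\ge0$. Then the equation $u(x)=\int_0^x k(x,s)g(u(s))\,ds$ has at most one positive solution; that is, any two positive solutions on the same interval $[0,X]$, $X>0$, coincide.
   Context: General conditions (GC) on a pair $(k,g)$: - (K1) $k:\mathbb{R}^2\to[0,\infty)$ is a (measurable) locally bounded function with $k(x,s)=0$ whenever $s>x$. - (K2) For every $x\in\mathbb{R}$ the map $s\mapsto k(x,s)$ is locally integrable, and $K(x)=\int_0^x k(x,s)\,ds$, $x\ge 0$, is strictly increasing. - (G1) $g:\mathbb{R}\to[0,\infty)$ is continuous, vanishes on $(-\infty,0]$, is strictly increasing on $[0,\infty)$, and $g'>0$ almost everywhere on $(0,\infty)$. A positive solution on $[0,X]$ is a measurable bounded function $u$ on $[0,X]$ satisfying the equation for all $x\in[0,X]$ and with $u>0$ on $(0,X]$. *)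

theory Defs
  imports "HOL-Analysis.Analysis"
begin

text \<open>
  Kernels \<open>k : \<real>\<^sup>2 \<rightarrow> \<real>\<close> are curried. Measurability and integrals are with respect to
  Lebesgue measure; \<open>g' > 0\<close> almost everywhere includes that \<open>g'\<close> exists almost everywhere.
\<close>

definition locally_bounded :: "('a::metric_space \<Rightarrow> real) \<Rightarrow> bool" where
  "locally_bounded f \<longleftrightarrow> (\<forall>C. compact C \<longrightarrow> bounded (f ` C))"

definition locally_integrable :: "('a::euclidean_space \<Rightarrow> real) \<Rightarrow> bool" where
  "locally_integrable f \<longleftrightarrow> (\<forall>C. compact C \<longrightarrow> set_integrable lebesgue C f)"

definition kernel_integral :: "(real \<Rightarrow> real \<Rightarrow> real) \<Rightarrow> real \<Rightarrow> real" where
  "kernel_integral k x = (LINT s:{0..x}|lebesgue. k x s)"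

definition K1 :: "(real \<Rightarrow> real \<Rightarrow> real) \<Rightarrow> bool" where
  "K1 k \<longleftrightarrow>
     (\<forall>x s. 0 \<le> k x s) \<and>
     (\<lambda>(x, s). k x s) \<in> borel_measurable lebesgue \<and>
     locally_bounded (\<lambda>(x, s). k x s) \<and>
     (\<forall>x s. x < s \<longrightarrow> k x s = 0)"

definition K2 :: "(real \<Rightarrow> real \<Rightarrow> real) \<Rightarrow> bool" where
  "K2 k \<longleftrightarrow>
     (\<forall>x. locally_integrable (k x)) \<and>
     strict_mono_on {0..} (kernel_integral k)"

definition K3 :: "(real \<Rightarrow> real \<Rightarrow> real) \<Rightarrow> bool" where
  "K3 k \<longleftrightarrow> continuous_on {0..} (kernel_integral k)"

definition K4 :: "(real \<Rightarrow> real \<Rightarrow> real) \<Rightarrow> bool" where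
  "K4 k \<longleftrightarrow> (\<forall>x s l. 0 \<le> l \<longrightarrow> k x s \<le> k (x + l) (s + l))"

definition G1 :: "(real \<Rightarrow> real) \<Rightarrow> bool" where
  "G1 g \<longleftrightarrow>
     (\<forall>x. 0 \<le> g x) \<and>
     continuous_on UNIV g \<and>
     (\<forall>x\<le>0. g x = 0) \<and>
     strict_mono_on {0..} g \<and>
     (AE x in lebesgue. 0 < x \<longrightarrow> (\<exists>D>0. (g has_real_derivative D) (at x)))"

definition general_conditions :: "(real \<Rightarrow> real \<Rightarrow> real) \<Rightarrow> (real \<Rightarrow> real) \<Rightarrow> bool" where
  "general_conditions k g \<longleftrightarrow> K1 k \<and> K2 k \<and> G1 g"

text \<open>
  Under the general conditions the integrand below is Lebesgue integrable for every bounded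
  measurable \<open>u\<close>, so the default value of the Bochner integral plays no role.
  Only the values of \<open>u\<close> on \<open>[0, X]\<close> matter.
\<close>

definition positive_solution ::
  "(real \<Rightarrow> real \<Rightarrow> real) \<Rightarrow> (real \<Rightarrow> real) \<Rightarrow> real \<Rightarrow> (real \<Rightarrow> real) \<Rightarrow> bool" where
  "positive_solution k g X u \<longleftrightarrow>
     u \<in> borel_measurable (lebesgue_on {0..X}) \<and>
     bounded (u ` {0..X}) \<and>
     (\<forall>x\<in>{0..X}. u x = (LINT s:{0..x}|lebesgue. k x s * g (u s))) \<and>
     (\<forall>x\<in>{0<..X}. 0 < u x)"

end

theory Submission
  imports Defs
begin

text \<open>
  Write \<open>u\<^sub>h(x) = u(x - h)\<close> for a positive solution \<open>u\<close> delayed by \<open>h > 0\<close> and extended by zero. Since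
  the kernel grows along diagonals (K4), \<open>u\<^sub>h\<close> is a subsolution of the same equation, and it vanishes
  on \<open>[0, h]\<close>, whereas any other positive solution \<open>v\<close> is positive on \<open>(0, h]\<close>. This head start removes the
  degeneracy at the origin (the equation also has the solution zero): \<open>u\<^sub>h\<close> can never catch up with
  \<open>v\<close>, because at a first meeting point \<open>c\<close> the strict monotonicity of \<open>g\<close> and the positivity of
  \<open>K(c)\<close> make the integral for \<open>v\<close> strictly larger (\<open>shifted_solution_less\<close>). Letting \<open>h\<close> tend to
  zero yields \<open>u \<le> v\<close>, and exchanging the roles of \<open>u\<close> and \<open>v\<close> yields equality.

  A first meeting point and the limit \<open>h \<rightarrow> 0\<close> both need solutions to be continuous, whereas they are
  only assumed to be bounded and measurable. Continuity (\<open>positive_solution_continuous\<close>) rests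
  on K3 and K4 together: for \<open>h \<ge> 0\<close> the kernels \<open>k(x+h, \<cdot>)\<close> and \<open>k(x, \<cdot> - h)\<close> are ordered, so their
  distance in the mean on \<open>[h, x+h]\<close> is at most the increment \<open>K(x+h) - K(x)\<close>, while the bounded measurable
  function \<open>g \<circ> u\<close> is close to its own translates in the mean (\<open>L1_translation_tendsto\<close>).
\<close>

section \<open>Continuity of translations in the mean\<close>

lemma integrable_translate:
  fixes f :: "real \<Rightarrow> real"
  assumes "integrable lebesgue f"
  shows "integrable lebesgue (\<lambda>s. f (s + t))"
  using lebesgue_integrable_real_affine_iff[of 1 f t] assms by (simp add: add.commute)

lemma integral_translate:
  fixes f :: "real \<Rightarrow> real"
  shows "(LINT s|lebesgue. f (s + t)) = (LINT s|lebesgue. f s)"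
  using lebesgue_integral_real_affine[of 1 f t] by (simp add: add.commute)

definition L1_translation_distance :: "(real \<Rightarrow> real) \<Rightarrow> real \<Rightarrow> real" where
  "L1_translation_distance f t = (LINT s|lebesgue. \<bar>f (s + t) - f s\<bar>)"

lemma L1_translation_distance_nonneg: "0 \<le> L1_translation_distance f t"
  by (simp add: L1_translation_distance_def)

lemma L1_translation_distance_triangle:
  assumes f: "integrable lebesgue f" and g: "integrable lebesgue g"
  shows "L1_translation_distance (\<lambda>s. f s + g s) t
           \<le> L1_translation_distance f t + L1_translation_distance g t"
proof -
  note [intro] = integrable_translate[OF f] integrable_translate[OF g] f g
  have "L1_translation_distance (\<lambda>s. f s + g s) t
        \<le> (LINT s|lebesgue. \<bar>f (s + t) - f s\<bar> + \<bar>g (s + t) - g s\<bar>)"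
    unfolding L1_translation_distance_def
    by (rule integral_mono)
      (auto intro!: Bochner_Integration.integrable_diff Bochner_Integration.integrable_add
        integrable_abs)
  also have "\<dots> = L1_translation_distance f t + L1_translation_distance g t"
    unfolding L1_translation_distance_def
    by (rule Bochner_Integration.integral_add) (auto intro!: Bochner_Integration.integrable_diff integrable_abs)
  finally show ?thesis .
qed

lemma L1_translation_distance_le_L1_norm:
  assumes f: "integrable lebesgue f"
  shows "L1_translation_distance f t \<le> 2 * (LINT s|lebesgue. \<bar>f s\<bar>)"
proof -
  note [intro] = integrable_translate[OF f] f
  have "L1_translation_distance f t \<le> (LINT s|lebesgue. \<bar>f (s + t)\<bar> + \<bar>f s\<bar>)"
    unfolding L1_translation_distance_def
    by (rule integral_mono)
      (auto intro!: Bochner_Integration.integrable_diff Bochner_Integration.integrable_add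
        integrable_abs)
  also have "\<dots> = (LINT s|lebesgue. \<bar>f (s + t)\<bar>) + (LINT s|lebesgue. \<bar>f s\<bar>)"
    by (rule Bochner_Integration.integral_add) (auto intro!: Bochner_Integration.integrable_diff integrable_abs)
  finally show ?thesis
    using integral_translate[of "\<lambda>s. \<bar>f s\<bar>" t] by simp
qed

text \<open>
  The functions on which translation is continuous in the mean form a closed set in
  \<open>L\<^sup>1\<close>: replacing \<open>f\<close> by an approximation \<open>g\<close> changes the translation distance by at most
  twice the distance of \<open>f\<close> and \<open>g\<close>, uniformly in the translation.
\<close>
lemma L1_translation_tendsto_closure:
  assumes f: "integrable lebesgue f"
    and approx: "\<And>e. 0 < e \<Longrightarrow> \<exists>g. integrable lebesgue g \<and>
        (L1_translation_distance g \<longlongrightarrow> 0) (at 0) \<and> (LINT s|lebesgue. \<bar>f s - g s\<bar>) < e"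
  shows "(L1_translation_distance f \<longlongrightarrow> 0) (at 0)"
proof (rule tendstoI)
  fix e :: real assume "0 < e"
  then obtain g where g: "integrable lebesgue g" "(L1_translation_distance g \<longlongrightarrow> 0) (at 0)"
    and close: "(LINT s|lebesgue. \<bar>f s - g s\<bar>) < e / 3"
    using approx[of "e / 3"] by auto
  have "\<forall>\<^sub>F t in at 0. dist (L1_translation_distance g t) 0 < e / 3"
    using tendstoD[OF g(2), of "e / 3"] \<open>0 < e\<close> by simp
  then show "\<forall>\<^sub>F t in at 0. dist (L1_translation_distance f t) 0 < e"
  proof eventually_elim
    fix t assume t: "dist (L1_translation_distance g t) 0 < e / 3"
    have d: "integrable lebesgue (\<lambda>s. f s - g s)"
      using f g by auto
    have "L1_translation_distance f t
          \<le> L1_translation_distance (\<lambda>s. f s - g s) t + L1_translation_distance g t"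
      using L1_translation_distance_triangle[OF d g(1)] by simp
    with t close L1_translation_distance_le_L1_norm[OF d, of t]
      L1_translation_distance_nonneg[of f t]
    show "dist (L1_translation_distance f t) 0 < e"
      by (simp add: dist_real_def)
  qed
qed

lemma L1_translation_tendsto_cmult:
  assumes "(L1_translation_distance f \<longlongrightarrow> 0) (at 0)"
  shows "(L1_translation_distance (\<lambda>s. f s * c) \<longlongrightarrow> 0) (at 0)"
proof -
  have "L1_translation_distance (\<lambda>s. f s * c) = (\<lambda>t. L1_translation_distance f t * \<bar>c\<bar>)"
    unfolding L1_translation_distance_def
    by (simp add: fun_eq_iff left_diff_distrib[symmetric] abs_mult)
  then show ?thesis
    using tendsto_mult_left_zero[OF assms] by simp
qed

text \<open>
  Openness gives pointwise convergence of the positive part of \<open>1\<^sub>U(s) - 1\<^sub>U(s + t)\<close>, since a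
  point of \<open>U\<close> stays in \<open>U\<close> under small translations. That is half of the claim; the other half
  is free, because translation invariance forces the positive and the negative part of the
  difference to have the same integral.
\<close>
lemma L1_translation_tendsto_open:
  fixes U :: "real set"
  assumes U: "open U" "integrable lebesgue (indicat_real U)"
  shows "(L1_translation_distance (indicat_real U) \<longlongrightarrow> 0) (at 0)"
proof (subst tendsto_at_iff_sequentially, intro allI impI)
  let ?I = "indicat_real U"
  fix X :: "nat \<Rightarrow> real" assume "X \<longlonglongrightarrow> 0"
  note [intro] = integrable_translate[OF U(2)] U(2)
  define p where "p n s = max 0 (?I s - ?I (s + X n))" for n s
  have p_int: "integrable lebesgue (p n)" for n
    unfolding p_def by (auto intro!: Bochner_Integration.integrable_diff integrable_max)
  have pw: "(\<lambda>n. p n s) \<longlonglongrightarrow> 0" for s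
  proof (cases "s \<in> U")
    case True
    have "(\<lambda>n. s + X n) \<longlonglongrightarrow> s + 0"
      by (intro tendsto_intros \<open>X \<longlonglongrightarrow> 0\<close>)
    then have "\<forall>\<^sub>F n in sequentially. s + X n \<in> U"
      using U(1) True by (auto elim!: topological_tendstoD)
    then have "\<forall>\<^sub>F n in sequentially. p n s = 0"
      by eventually_elim (auto simp: p_def True)
    then show ?thesis by (rule tendsto_eventually)
  next
    case False
    then have "p n s = 0" for n by (simp add: p_def)
    then show ?thesis by simp
  qed
  have "(\<lambda>n. LINT s|lebesgue. p n s) \<longlonglongrightarrow> (LINT s::real|lebesgue. (0::real))"
  proof (rule integral_dominated_convergence[where w = ?I])
    show "p n \<in> borel_measurable lebesgue" for n
      using p_int by (rule borel_measurable_integrable)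
    show "AE s in lebesgue. norm (p n s) \<le> ?I s" for n
      by (auto simp: p_def indicator_def)
  qed (use pw U(2) in auto)
  then have lim: "(\<lambda>n. 2 * (LINT s|lebesgue. p n s)) \<longlonglongrightarrow> 0"
    using tendsto_mult_right_zero[of _ sequentially 2] by simp
  have "L1_translation_distance ?I (X n) = 2 * (LINT s|lebesgue. p n s)" for n
  proof -
    \<comment> \<open>\<open>\<bar>b - a\<bar> = 2 * max 0 (a - b) + (b - a)\<close>, and the last summand integrates to zero.\<close>
    have "L1_translation_distance ?I (X n) = (LINT s|lebesgue. 2 * p n s + (?I (s + X n) - ?I s))"
      unfolding L1_translation_distance_def p_def
      by (rule Bochner_Integration.integral_cong) (auto simp: max_def)
    also have "\<dots> = (LINT s|lebesgue. 2 * p n s) + (LINT s|lebesgue. ?I (s + X n) - ?I s)"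
      by (rule Bochner_Integration.integral_add) (auto intro!: Bochner_Integration.integrable_diff p_int)
    also have "(LINT s|lebesgue. ?I (s + X n) - ?I s) = 0"
      using integral_translate[of ?I "X n"]
      by (subst Bochner_Integration.integral_diff) auto
    finally show ?thesis by simp
  qed
  with lim show "(L1_translation_distance ?I \<circ> X) \<longlonglongrightarrow> 0"
    by (simp add: comp_def)
qed

lemma L1_translation_tendsto_indicator:
  fixes A :: "real set"
  assumes A: "A \<in> sets lebesgue" "emeasure lebesgue A < \<infinity>"
  shows "(L1_translation_distance (indicat_real A) \<longlongrightarrow> 0) (at 0)"
proof (rule L1_translation_tendsto_closure)
  show A_int: "integrable lebesgue (indicat_real A)"
    using A by (simp add: integrable_indicator_iff)
  fix e :: real assume "0 < e"
  then obtain U where U: "open U" "A \<subseteq> U" "U - A \<in> lmeasurable"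
    and small: "emeasure lebesgue (U - A) < ennreal e"
    using sets_lebesgue_outer_open[OF A(1)] by blast
  have ind: "indicat_real U s = indicat_real A s + indicat_real (U - A) s" for s
    using U(2) by (auto simp: indicator_def)
  have D_int: "integrable lebesgue (indicat_real (U - A))"
    using fmeasurableD[OF U(3)] small by (intro integrable_real_indicator) (auto intro: order.strict_trans)
  then have U_int: "integrable lebesgue (indicat_real U)"
    using A_int by (simp add: ind[abs_def])
  have "(LINT s|lebesgue. \<bar>indicat_real A s - indicat_real U s\<bar>) = measure lebesgue (U - A)"
    by (simp add: ind)
  also have "\<dots> < e"
    using small \<open>0 < e\<close> by (metis U(3) emeasure_eq_measure2 ennreal_less_iff measure_nonneg)
  finally show "\<exists>g. integrable lebesgue g \<and>
        (L1_translation_distance g \<longlongrightarrow> 0) (at 0) \<and> (LINT s|lebesgue. \<bar>indicat_real A s - g s\<bar>) < e"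
    using U_int L1_translation_tendsto_open[OF U(1) U_int] by blast
qed

text \<open>
  From open sets one reaches measurable sets by outer regularity, and all integrable functions by
  linearity and dominated convergence.
\<close>
lemma L1_translation_tendsto:
  assumes "integrable lebesgue f"
  shows "(L1_translation_distance f \<longlongrightarrow> 0) (at 0)"
  using assms
proof (induction rule: integrable_induct)
  case (base A c)
  then show ?case
    using L1_translation_tendsto_cmult[OF L1_translation_tendsto_indicator] by simp
next
  case (add f g)
  show ?case
  proof (rule tendsto_sandwich[OF _ _ tendsto_const])
    show "((\<lambda>t. L1_translation_distance f t + L1_translation_distance g t) \<longlongrightarrow> 0) (at 0)"
      using tendsto_add[OF add.IH] by simp
  qed (use add L1_translation_distance_triangle in \<open>auto simp: L1_translation_distance_nonneg\<close>)
next
  case (lim f s)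
  have s_int: "integrable lebesgue (s i)" and s_conv: "(\<lambda>i. s i x) \<longlonglongrightarrow> f x"
    and s_bound: "\<bar>s i x\<bar> \<le> 2 * \<bar>f x\<bar>" and f_int: "integrable lebesgue f" for i x
    using lim.hyps by auto
  have "(\<lambda>i. LINT x|lebesgue. \<bar>f x - s i x\<bar>) \<longlonglongrightarrow> (LINT x::real|lebesgue. (0::real))"
  proof (rule integral_dominated_convergence[where w = "\<lambda>x. 3 * \<bar>f x\<bar>"])
    show "AE x in lebesgue. (\<lambda>i. \<bar>f x - s i x\<bar>) \<longlonglongrightarrow> 0"
    proof (rule AE_I2)
      fix x :: real
      have "(\<lambda>i. \<bar>f x - s i x\<bar>) \<longlonglongrightarrow> \<bar>f x - f x\<bar>"
        by (intro tendsto_rabs tendsto_diff tendsto_const s_conv)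
      then show "(\<lambda>i. \<bar>f x - s i x\<bar>) \<longlonglongrightarrow> 0" by simp
    qed
    show "AE x in lebesgue. norm \<bar>f x - s i x\<bar> \<le> 3 * \<bar>f x\<bar>" for i
    proof (rule AE_I2)
      fix x :: real
      show "norm \<bar>f x - s i x\<bar> \<le> 3 * \<bar>f x\<bar>"
        using s_bound[of i x] abs_triangle_ineq4[of "f x" "s i x"] by simp
    qed
    show "(\<lambda>x. \<bar>f x - s i x\<bar>) \<in> borel_measurable lebesgue" for i
      using s_int[of i] f_int by (intro borel_measurable_integrable) auto
  qed (use f_int in auto)
  then have conv: "(\<lambda>i. LINT x|lebesgue. \<bar>f x - s i x\<bar>) \<longlonglongrightarrow> 0" by simp
  show ?case
  proof (rule L1_translation_tendsto_closure[OF f_int])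
    fix e :: real assume "0 < e"
    then obtain i where "(LINT x|lebesgue. \<bar>f x - s i x\<bar>) < e"
      using order_tendstoD(2)[OF conv] eventually_happens by fastforce
    then show "\<exists>g. integrable lebesgue g \<and>
        (L1_translation_distance g \<longlongrightarrow> 0) (at 0) \<and> (LINT x|lebesgue. \<bar>f x - g x\<bar>) < e"
      using s_int lim.IH by blast
  qed
qed

section \<open>The equation as an integral over the whole line\<close>

text \<open>
  Extending \<open>g \<circ> u\<close> by zero outside \<open>[0, X]\<close> turns \<open>\<integral>\<^sub>0\<^sup>x k(x,s) g(u(s)) ds\<close> into an integral over
  all of \<open>\<real>\<close> for every \<open>x \<le> X\<close>, the part beyond \<open>x\<close> being killed by the kernel. Translating
  such an integral does not move any limits of integration.
\<close>
definition cutoff :: "real \<Rightarrow> (real \<Rightarrow> real) \<Rightarrow> real \<Rightarrow> real" where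
  "cutoff X f s = (if s \<in> {0..X} then f s else 0)"

lemma cutoff_out: "s \<notin> {0..X} \<Longrightarrow> cutoff X f s = 0"
  unfolding cutoff_def by (rule if_not_P)

lemma cutoff_neg: "s < 0 \<Longrightarrow> cutoff X f s = 0"
  by (simp add: cutoff_def)

lemma forcing_bounded_integrable:
  assumes g: "G1 g" and u: "positive_solution k g X u"
  shows "\<exists>M. \<forall>s. cutoff X (g \<circ> u) s \<le> M" and "integrable lebesgue (cutoff X (g \<circ> u))"
    and "0 \<le> cutoff X (g \<circ> u) s"
proof -
  have g_cont: "continuous_on UNIV g" and g_nonneg: "0 \<le> g y" for y
    using g by (auto simp: G1_def)
  show nonneg: "0 \<le> cutoff X (g \<circ> u) s" for s
    by (simp add: cutoff_def g_nonneg)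
  obtain b where b: "\<And>s. s \<in> {0..X} \<Longrightarrow> \<bar>u s\<bar> \<le> b"
    using u by (force simp: positive_solution_def bounded_iff)
  have "compact (g ` {-b..b})"
    by (rule compact_continuous_image[OF continuous_on_subset[OF g_cont]]) auto
  then obtain M where M: "\<And>y. y \<in> {-b..b} \<Longrightarrow> \<bar>g y\<bar> \<le> M"
    using compact_imp_bounded by (force simp: bounded_iff)
  have bound: "cutoff X (g \<circ> u) s \<le> max 0 M" for s
  proof (cases "s \<in> {0..X}")
    case True
    then have "u s \<in> {-b..b}" using b[of s] by auto
    then show ?thesis using M[of "u s"] True by (simp add: cutoff_def)
  next
    case False
    then have "cutoff X (g \<circ> u) s = 0" unfolding cutoff_def by (rule if_not_P)
    then show ?thesis by simp
  qed
  then show "\<exists>M. \<forall>s. cutoff X (g \<circ> u) s \<le> M" by blast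
  have "u \<in> borel_measurable (lebesgue_on {0..X})"
    using u by (simp add: positive_solution_def)
  then have "g \<circ> u \<in> borel_measurable (lebesgue_on {0..X})"
    using borel_measurable_continuous_onI[OF g_cont] by (rule measurable_comp)
  then have "(\<lambda>s. if s \<in> {0..X} then (g \<circ> u) s else 0) \<in> borel_measurable lebesgue"
    by (rule borel_measurable_if_I) simp
  then have meas: "cutoff X (g \<circ> u) \<in> borel_measurable lebesgue"
    by (simp add: cutoff_def[abs_def])
  have "integrable lebesgue (\<lambda>s. max 0 M * indicat_real {0..X} s)"
    by (intro Bochner_Integration.integrable_mult_right integrable_real_indicator)
      (auto simp: emeasure_lborel_Icc_eq)
  then show "integrable lebesgue (cutoff X (g \<circ> u))"
    by (rule Bochner_Integration.integrable_bound[OF _ meas])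
      (use nonneg bound in \<open>auto simp: cutoff_out indicator_def abs_of_nonneg\<close>)
qed

lemma integrable_kernel_mult:
  assumes k: "K1 k" "K2 k"
    and f: "f \<in> borel_measurable lebesgue" "\<And>s. \<bar>f s\<bar> \<le> M" "\<And>s. s < 0 \<Longrightarrow> f s = 0"
  shows "integrable lebesgue (\<lambda>s. k x s * f s)"
proof -
  have k_zero: "k x s = 0" if "x < s" for s
    using k(1) that by (simp add: K1_def)
  have "set_integrable lebesgue {0..x} (k x)"
    using k(2) by (simp add: K2_def locally_integrable_def)
  then have i: "integrable lebesgue (\<lambda>s. indicat_real {0..x} s * k x s)"
    by (simp add: set_integrable_def)
  have eq: "k x s * f s = indicat_real {0..x} s * k x s * f s" for s
    by (cases "s < 0"; cases "x < s") (auto simp: indicator_def f(3) k_zero)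
  have "integrable lebesgue (\<lambda>s. indicat_real {0..x} s * k x s * f s)"
  proof (rule Bochner_Integration.integrable_bound)
    show "integrable lebesgue (\<lambda>s. M * (indicat_real {0..x} s * k x s))"
      using i by (rule Bochner_Integration.integrable_mult_right)
    show "(\<lambda>s. indicat_real {0..x} s * k x s * f s) \<in> borel_measurable lebesgue"
      using borel_measurable_integrable[OF i] f(1) by (rule borel_measurable_times)
    have "norm (indicat_real {0..x} s * k x s * f s) \<le> norm (M * (indicat_real {0..x} s * k x s))" for s
    proof -
      have "\<bar>f s\<bar> * \<bar>indicat_real {0..x} s * k x s\<bar> \<le> \<bar>M\<bar> * \<bar>indicat_real {0..x} s * k x s\<bar>"
        using f(2)[of s] by (intro mult_right_mono) auto
      then show ?thesis by (simp add: abs_mult mult.commute mult.left_commute)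
    qed
    then show "AE s in lebesgue. norm (indicat_real {0..x} s * k x s * f s)
        \<le> norm (M * (indicat_real {0..x} s * k x s))"
      by simp
  qed
  then show ?thesis by (simp only: eq)
qed

lemma kernel_integral_eq_LINT:
  assumes "K1 k"
  shows "kernel_integral k x = (LINT s|lebesgue. k x s * indicat_real {0..} s)"
  unfolding kernel_integral_def set_lebesgue_integral_def
  using assms by (intro Bochner_Integration.integral_cong) (auto simp: indicator_def K1_def)

lemma positive_solution_eq_LINT:
  assumes k: "K1 k" and u: "positive_solution k g X u" and x: "x \<in> {0..X}"
  shows "u x = (LINT s|lebesgue. k x s * cutoff X (g \<circ> u) s)"
proof -
  have "u x = (LINT s:{0..x}|lebesgue. k x s * g (u s))"
    using u x by (simp add: positive_solution_def)
  also have "\<dots> = (LINT s|lebesgue. k x s * cutoff X (g \<circ> u) s)"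
    unfolding set_lebesgue_integral_def
    using assms x by (intro Bochner_Integration.integral_cong) (auto simp: indicator_def K1_def cutoff_def)
  finally show ?thesis .
qed

section \<open>Continuity of solutions\<close>

lemma kernel_shift_mono:
  assumes "K4 k" "0 \<le> h"
  shows "k x (s - h) \<le> k (x + h) s"
  using assms(1)[unfolded K4_def, rule_format, OF assms(2), of x "s - h"] by simp

text \<open>
  After the translation \<open>s \<mapsto> s - h\<close> of the integral at \<open>x\<close>, the integrands at \<open>x + h\<close> and \<open>x\<close>
  differ by
  \<open>(k(x+h,s) - k(x,s-h)) G(s-h) + k(x+h,s) (G(s) - G(s-h))\<close>.
  By K4 the first bracket is nonnegative, so its integral over \<open>s \<ge> h\<close> needs no absolute values
  and is at most \<open>K(x+h) - K(x)\<close>. The second term is controlled by the distance of \<open>G\<close> from its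
  translate, which tends to zero with \<open>h\<close> for any integrable \<open>G\<close>.
\<close>
lemma volterra_increment_bound:
  fixes k :: "real \<Rightarrow> real \<Rightarrow> real" and G :: "real \<Rightarrow> real"
  assumes k: "K1 k" "K2 k" "K4 k" and x: "0 \<le> x" and h: "0 \<le> h"
    and G: "integrable lebesgue G" "\<And>s. 0 \<le> G s" "\<And>s. G s \<le> M" "\<And>s. s < 0 \<Longrightarrow> G s = 0"
    and B: "\<And>s. s \<in> {0..x + h} \<Longrightarrow> k (x + h) s \<le> B"
  shows "\<bar>(LINT s|lebesgue. k (x + h) s * G s) - (LINT s|lebesgue. k x s * G s)\<bar>
    \<le> M * (kernel_integral k (x + h) - kernel_integral k x) + B * L1_translation_distance G (- h)"
proof -
  let ?H = "indicat_real {0..}"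
  have k_nonneg: "0 \<le> k y s" and k_zero: "y < s \<Longrightarrow> k y s = 0" for y s
    using k(1) by (auto simp: K1_def)
  have G_abs: "\<bar>G s\<bar> \<le> M" for s
    using G(2,3)[of s] by simp
  note G_meas = borel_measurable_integrable[OF G(1)]
  have i1: "integrable lebesgue (\<lambda>s. k (x + h) s * G s)"
    by (rule integrable_kernel_mult[OF k(1,2) G_meas G_abs G(4)])
  have i2: "integrable lebesgue (\<lambda>s. k x (s - h) * G (s - h))"
    using integrable_translate[OF integrable_kernel_mult[OF k(1,2) G_meas G_abs G(4), of x], of "- h"]
    by simp
  have i3: "integrable lebesgue (\<lambda>s. k (x + h) s * ?H s)"
    by (rule integrable_kernel_mult[OF k(1,2), where M = 1])
      (auto simp: abs_indicator indicator_le_1 borel_measurable_indicator)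
  have i4: "integrable lebesgue (\<lambda>s. k x (s - h) * ?H (s - h))"
    using integrable_translate[OF integrable_kernel_mult[OF k(1,2), of ?H 1 x], of "- h"]
    by (simp add: indicator_le_1 abs_indicator borel_measurable_indicator)
  have i5: "integrable lebesgue (\<lambda>s. \<bar>G (s - h) - G s\<bar>)"
    using integrable_translate[OF G(1), of "- h"] G(1) by auto

  have split: "k (x + h) s * G s - k x (s - h) * G (s - h)
      = (k (x + h) s - k x (s - h)) * G (s - h) + k (x + h) s * (G s - G (s - h))" for s
    by (simp add: algebra_simps)
  have pw1: "\<bar>(k (x + h) s - k x (s - h)) * G (s - h)\<bar>
      \<le> M * (k (x + h) s * ?H s - k x (s - h) * ?H (s - h))" for s
  proof (cases "s < h")
    case True
    have "0 \<le> M * (k (x + h) s * ?H s)"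
      using G(2,3)[of 0] k_nonneg by (intro mult_nonneg_nonneg) auto
    with True show ?thesis by (simp add: G(4))
  next
    case False
    have "0 \<le> k (x + h) s - k x (s - h)"
      using kernel_shift_mono[OF k(3) h] by simp
    then have "\<bar>(k (x + h) s - k x (s - h)) * G (s - h)\<bar> \<le> (k (x + h) s - k x (s - h)) * M"
      using G_abs[of "s - h"] by (simp add: abs_mult mult_left_mono)
    with False h show ?thesis by (simp add: mult.commute)
  qed
  have pw2: "\<bar>k (x + h) s * (G s - G (s - h))\<bar> \<le> B * \<bar>G (s - h) - G s\<bar>" for s
  proof (cases "s \<in> {0..x + h}")
    case True
    then show ?thesis
      using B[OF True] k_nonneg[of "x + h" s]
      by (simp add: abs_mult abs_minus_commute[of "G s"] mult_right_mono)
  next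
    case False
    then consider "s < 0" | "x + h < s" by force
    then show ?thesis
    proof cases
      case 1
      then show ?thesis using h by (simp add: G(4))
    next
      case 2
      then have "k (x + h) s = 0" by (rule k_zero)
      moreover have "0 \<le> B"
        using B[of 0] k_nonneg[of "x + h" 0] x h by simp
      ultimately show ?thesis by simp
    qed
  qed
  have "(LINT s|lebesgue. k (x + h) s * G s) - (LINT s|lebesgue. k x s * G s)
      = (LINT s|lebesgue. k (x + h) s * G s) - (LINT s|lebesgue. k x (s - h) * G (s - h))"
    using integral_translate[of "\<lambda>s. k x s * G s" "- h"] by simp
  also have "\<dots> = (LINT s|lebesgue. k (x + h) s * G s - k x (s - h) * G (s - h))"
    using i1 i2 by (rule Bochner_Integration.integral_diff[symmetric])
  finally have "\<bar>(LINT s|lebesgue. k (x + h) s * G s) - (LINT s|lebesgue. k x s * G s)\<bar>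
      \<le> (LINT s|lebesgue. \<bar>k (x + h) s * G s - k x (s - h) * G (s - h)\<bar>)"
    by (simp add: integral_abs_bound)
  also have "\<dots> \<le> (LINT s|lebesgue. M * (k (x + h) s * ?H s - k x (s - h) * ?H (s - h))
                        + B * \<bar>G (s - h) - G s\<bar>)"
  proof (rule integral_mono)
    show "\<bar>k (x + h) s * G s - k x (s - h) * G (s - h)\<bar>
        \<le> M * (k (x + h) s * ?H s - k x (s - h) * ?H (s - h)) + B * \<bar>G (s - h) - G s\<bar>" for s
      unfolding split by (rule order_trans[OF abs_triangle_ineq add_mono[OF pw1 pw2]])
  qed (use i1 i2 i3 i4 i5 in auto)
  also have "\<dots> = M * ((LINT s|lebesgue. k (x + h) s * ?H s) - (LINT s|lebesgue. k x (s - h) * ?H (s - h)))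
                        + B * (LINT s|lebesgue. \<bar>G (s - h) - G s\<bar>)"
    using i3 i4 i5 by simp
  also have "(LINT s|lebesgue. k x (s - h) * ?H (s - h)) = kernel_integral k x"
    using integral_translate[of "\<lambda>s. k x s * ?H s" "- h"] kernel_integral_eq_LINT[OF k(1)] by simp
  finally show ?thesis
    by (simp add: kernel_integral_eq_LINT[OF k(1)] L1_translation_distance_def)
qed

lemma locally_bounded_kernel_obtains:
  assumes "K1 k"
  obtains B where "0 < B" "\<And>x s. x \<in> {0..X} \<Longrightarrow> s \<in> {0..X} \<Longrightarrow> k x s \<le> B"
proof -
  have "compact ({0..X} \<times> {0..X})"
    by (intro compact_Times compact_Icc)
  then have "bounded ((\<lambda>(x, s). k x s) ` ({0..X} \<times> {0..X}))"
    using assms by (simp add: K1_def locally_bounded_def)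
  then obtain B where "0 < B" "\<forall>p\<in>(\<lambda>(x, s). k x s) ` ({0..X} \<times> {0..X}). norm p \<le> B"
    unfolding bounded_pos by blast
  then show ?thesis by (intro that[of B]) force+
qed

text \<open>
  Both terms of \<open>volterra_increment_bound\<close> tend to zero with \<open>h\<close>, uniformly in \<open>x\<close>: the first
  because \<open>K\<close> is uniformly continuous on \<open>[0, X]\<close>, the second by continuity of translations in
  the mean.
\<close>
lemma positive_solution_continuous:
  assumes k: "K1 k" "K2 k" "K3 k" "K4 k" and g: "G1 g"
    and u: "positive_solution k g X u"
  shows "continuous_on {0..X} u"
proof (rule uniformly_continuous_imp_continuous, unfold uniformly_continuous_on_def, intro allI impI)
  let ?G = "cutoff X (g \<circ> u)" and ?K = "kernel_integral k"
  fix e :: real assume "0 < e"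
  obtain M0 where "\<And>s. ?G s \<le> M0"
    using forcing_bounded_integrable(1)[OF g u] by blast
  then obtain M where M: "0 < M" "\<And>s. ?G s \<le> M"
    by (meson max.cobounded1 max.cobounded2 order_trans less_le_trans zero_less_one)
  obtain B where B: "0 < B" "\<And>x s. x \<in> {0..X} \<Longrightarrow> s \<in> {0..X} \<Longrightarrow> k x s \<le> B"
    using locally_bounded_kernel_obtains[OF k(1)] by blast
  have "continuous_on {0..X} ?K"
    using k(3) unfolding K3_def by (rule continuous_on_subset) auto
  then have "uniformly_continuous_on {0..X} ?K"
    by (rule compact_uniformly_continuous) simp
  then obtain d1 where d1: "0 < d1"
      "\<And>x y. x \<in> {0..X} \<Longrightarrow> y \<in> {0..X} \<Longrightarrow> dist y x < d1 \<Longrightarrow> dist (?K y) (?K x) < e / (2 * M)"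
    unfolding uniformly_continuous_on_def using \<open>0 < e\<close> M(1)
    by (metis divide_pos_pos mult_pos_pos zero_less_numeral)
  have G_int: "integrable lebesgue ?G"
    using forcing_bounded_integrable(2)[OF g u] .
  have "\<forall>\<^sub>F t in at 0. dist (L1_translation_distance ?G t) 0 < e / (2 * B)"
    using tendstoD[OF L1_translation_tendsto[OF G_int]] \<open>0 < e\<close> B(1) by simp
  then have "\<exists>d>0. \<forall>t. t \<noteq> 0 \<and> \<bar>t\<bar> < d \<longrightarrow> L1_translation_distance ?G t < e / (2 * B)"
    unfolding eventually_at by (simp add: L1_translation_distance_nonneg)
  then obtain d2 where d2: "0 < d2"
      "\<And>t. t \<noteq> 0 \<Longrightarrow> \<bar>t\<bar> < d2 \<Longrightarrow> L1_translation_distance ?G t < e / (2 * B)"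
    by blast
  have close: "\<bar>u y - u x\<bar> < e" if xy: "x \<in> {0..X}" "y \<in> {0..X}" "x < y" "y - x < min d1 d2" for x y
  proof -
    have "\<bar>u y - u x\<bar> \<le> M * (?K y - ?K x) + B * L1_translation_distance ?G (- (y - x))"
      using volterra_increment_bound[OF k(1,2,4), of x "y - x" ?G M B] xy
        G_int M(2) B(2) forcing_bounded_integrable(3)[OF g u]
      by (auto simp: positive_solution_eq_LINT[OF k(1) u xy(1)]
          positive_solution_eq_LINT[OF k(1) u xy(2)] cutoff_def)
    also have "M * (?K y - ?K x) < M * (e / (2 * M))"
      using d1(2)[OF xy(1,2)] xy M(1) by (intro mult_strict_left_mono) (auto simp: dist_real_def)
    also have "B * L1_translation_distance ?G (- (y - x)) < B * (e / (2 * B))"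
      using d2(2)[of "- (y - x)"] xy B(1) by (intro mult_strict_left_mono) auto
    finally show ?thesis using M(1) B(1) by simp
  qed
  have "dist (u y) (u x) < e" if "x \<in> {0..X}" "y \<in> {0..X}" "dist y x < min d1 d2" for x y
    using close[of x y] close[of y x] that \<open>0 < e\<close>
    by (cases x y rule: linorder_cases) (auto simp: dist_real_def abs_minus_commute)
  then show "\<exists>d>0. \<forall>x\<in>{0..X}. \<forall>y\<in>{0..X}. dist y x < d \<longrightarrow> dist (u y) (u x) < e"
    using d1(1) d2(1) by (intro exI[of _ "min d1 d2"]) auto
qed

section \<open>Comparison of a delayed solution with a solution\<close>

lemma positive_solution_nonneg:
  assumes "K1 k" "G1 g" and u: "positive_solution k g X u" and x: "x \<in> {0..X}"
  shows "0 \<le> u x"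
  using assms unfolding positive_solution_eq_LINT[OF assms(1) u x]
  by (intro Bochner_Integration.integral_nonneg) (auto simp: K1_def G1_def cutoff_def)

text \<open>
  By K4 the delayed function \<open>x \<mapsto> u(x - h)\<close>, taken to be zero on \<open>[0, h]\<close>, satisfies the equation
  with \<open>\<le>\<close> in place of \<open>=\<close>. It starts strictly below \<open>v\<close>, because \<open>v\<close> is positive while the
  delayed function still vanishes on \<open>(0, h]\<close>. At a first point \<open>c\<close> where it reaches \<open>v\<close>, monotonicity of \<open>g\<close>
  makes the integrand for \<open>v\<close> at least as large as that for the delayed function, and the integrals
  can only be in the wrong order if \<open>k(c, s) = 0\<close> for almost all \<open>s\<close> in \<open>[0, c]\<close>. Then \<open>K(c) = 0\<close>,
  which contradicts the strict monotonicity of \<open>K\<close>.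
\<close>
lemma shifted_solution_less:
  assumes k: "K1 k" "K2 k" "K4 k" and g: "G1 g"
    and u: "positive_solution k g X u" "continuous_on {0..X} u"
    and v: "positive_solution k g X v" "continuous_on {0..X} v"
    and h: "0 < h" and x: "x \<in> {h..X}"
  shows "u (x - h) < v x"
proof (rule ccontr)
  assume "\<not> u (x - h) < v x"
  define S where "S = {y \<in> {h..X}. v y \<le> u (y - h)}"
  have "continuous_on {h..X} v" "continuous_on {h..X} (\<lambda>y. u (y - h))"
    using h by (auto intro!: continuous_on_subset[OF v(2)] continuous_on_compose2[OF u(2)] continuous_intros)
  then have "closed S"
    unfolding S_def by (intro continuous_on_closed_Collect_le) auto
  moreover have "S = {h..X} \<inter> S" by (auto simp: S_def)
  ultimately have "compact S"
    by (metis compact_Int_closed compact_Icc)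
  moreover have "S \<noteq> {}"
    using x \<open>\<not> u (x - h) < v x\<close> by (auto simp: S_def)
  ultimately obtain c where "c \<in> S" and c_min: "\<And>y. y \<in> S \<Longrightarrow> c \<le> y"
    using compact_attains_inf by metis
  then have c: "h \<le> c" "c \<le> X" "v c \<le> u (c - h)"
    and below: "\<And>y. h \<le> y \<Longrightarrow> y < c \<Longrightarrow> u (y - h) < v y"
    by (force simp: S_def)+
  let ?Gu = "cutoff X (g \<circ> u)" and ?Gv = "cutoff X (g \<circ> v)"
  have k_nonneg: "0 \<le> k y s" and k_zero: "y < s \<Longrightarrow> k y s = 0" for y s
    using k(1) by (auto simp: K1_def)
  obtain Mu Mv where M: "\<And>s. ?Gu s \<le> Mu" "\<And>s. ?Gv s \<le> Mv"
    using forcing_bounded_integrable(1)[OF g u(1)] forcing_bounded_integrable(1)[OF g v(1)] by blast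
  note G_nonneg = forcing_bounded_integrable(3)[OF g u(1)] forcing_bounded_integrable(3)[OF g v(1)]
  note Gu_int = forcing_bounded_integrable(2)[OF g u(1)] and Gv_int = forcing_bounded_integrable(2)[OF g v(1)]
  have i_v: "integrable lebesgue (\<lambda>s. k c s * ?Gv s)"
    by (rule integrable_kernel_mult[OF k(1,2), where M = Mv])
      (simp_all add: M G_nonneg cutoff_neg borel_measurable_integrable[OF Gv_int])
  have i_u: "integrable lebesgue (\<lambda>s. k c s * ?Gu (s - h))"
    by (rule integrable_kernel_mult[OF k(1,2), where M = Mu])
      (use h borel_measurable_integrable[OF integrable_translate[OF Gu_int, of "- h"]]
        in \<open>simp_all add: M G_nonneg cutoff_neg\<close>)
  have "integrable lebesgue (\<lambda>s. k (c - h) s * ?Gu s)"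
    by (rule integrable_kernel_mult[OF k(1,2), where M = Mu])
      (simp_all add: M G_nonneg cutoff_neg borel_measurable_integrable[OF Gu_int])
  from integrable_translate[OF this, of "- h"] have i_u':
    "integrable lebesgue (\<lambda>s. k (c - h) (s - h) * ?Gu (s - h))"
    by simp
  \<comment> \<open>The difference of the two integrands at the first crossing point.\<close>
  define w where "w s = k c s * ?Gv s - k c s * ?Gu (s - h)" for s
  have w_int: "integrable lebesgue w"
    unfolding w_def using i_v i_u by (rule Bochner_Integration.integrable_diff)
  have "u (c - h) = (LINT s|lebesgue. k (c - h) s * ?Gu s)"
    using c h by (intro positive_solution_eq_LINT[OF k(1) u(1)]) auto
  also have "\<dots> = (LINT s|lebesgue. k (c - h) (s - h) * ?Gu (s - h))"
    using integral_translate[of "\<lambda>s. k (c - h) s * ?Gu s" "- h"] by simp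
  also have "\<dots> \<le> (LINT s|lebesgue. k c s * ?Gu (s - h))"
    using kernel_shift_mono[OF k(3), of h "c - h"] h G_nonneg(1)
    by (intro integral_mono i_u i_u' mult_right_mono) auto
  finally have "v c \<le> (LINT s|lebesgue. k c s * ?Gu (s - h))"
    using c(3) by simp
  moreover have "v c = (LINT s|lebesgue. k c s * ?Gv s)"
    using c h by (intro positive_solution_eq_LINT[OF k(1) v(1)]) auto
  ultimately have w_le: "(LINT s|lebesgue. w s) \<le> 0"
    unfolding w_def using i_v i_u by simp
  have G_less: "?Gu (s - h) < ?Gv s" if "0 < s" "s < c" for s
  proof -
    have g_mono: "g a < g b" if "0 \<le> a" "a < b" for a b
      using g that by (auto simp: G1_def strict_mono_on_def)
    have g0: "g 0 = 0" using g by (simp add: G1_def)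
    show ?thesis
    proof (cases "s < h")
      case True
      have "0 < v s" using v(1) that c by (auto simp: positive_solution_def)
      then show ?thesis using True g_mono[of 0 "v s"] g0 that c by (simp add: cutoff_def)
    next
      case False
      then have "0 \<le> u (s - h)"
        using that c h by (intro positive_solution_nonneg[OF k(1) g u(1)]) auto
      then show ?thesis using g_mono[OF _ below[of s]] False that c h by (simp add: cutoff_def)
    qed
  qed
  have ne: "AE s in lebesgue. s \<noteq> 0 \<and> s \<noteq> c"
    using AE_completion[OF AE_lborel_singleton, of 0] AE_completion[OF AE_lborel_singleton, of c]
    by eventually_elim simp
  \<comment> \<open>The points \<open>0\<close> and \<open>c\<close> are left out because the strict inequality \<open>G_less\<close> fails there.\<close>
  have w_cases: "0 \<le> w s \<and> (w s = 0 \<longrightarrow> k c s * indicat_real {0..} s = 0)"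
    if nz: "s \<noteq> 0" "s \<noteq> c" for s
  proof -
    consider "s < 0" | "0 < s" "s < c" | "c < s"
      by (meson nz linorder_less_linear)
    then show ?thesis
    proof cases
      case 2
      then show ?thesis using G_less[of s] k_nonneg[of c s]
        by (auto simp: w_def right_diff_distrib[symmetric])
    qed (use h in \<open>auto simp: w_def k_zero cutoff_neg\<close>)
  qed
  have w_nonneg: "AE s in lebesgue. 0 \<le> w s"
    using ne by eventually_elim (use w_cases in blast)
  then have "(LINT s|lebesgue. w s) = 0"
    using w_le integral_nonneg_AE[of w lebesgue] by simp
  then have "AE s in lebesgue. w s = 0"
    using integral_nonneg_eq_0_iff_AE[OF w_int w_nonneg] by simp
  with ne have "AE s in lebesgue. k c s * indicat_real {0..} s = 0"
    by eventually_elim (use w_cases in blast)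
  then have "kernel_integral k c = 0"
    unfolding kernel_integral_eq_LINT[OF k(1)] by (rule integral_eq_zero_AE)
  moreover have "0 \<le> kernel_integral k 0"
    unfolding kernel_integral_eq_LINT[OF k(1)] using k_nonneg by (intro Bochner_Integration.integral_nonneg) auto
  moreover have "kernel_integral k 0 < kernel_integral k c"
    using k(2) c h by (auto simp: K2_def strict_mono_on_def)
  ultimately show False by simp
qed

text \<open>
  Letting the delay tend to zero in \<open>u(b - h) < v(b)\<close> gives \<open>u \<le> v\<close>, by continuity of both solutions.
\<close>
lemma positive_solution_le:
  assumes k: "K1 k" "K2 k" "K3 k" "K4 k" and g: "G1 g" and X: "0 < X"
    and u: "positive_solution k g X u" and v: "positive_solution k g X v" and x: "x \<in> {0..X}"
  shows "u x \<le> v x"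
proof (rule ccontr)
  assume "\<not> u x \<le> v x"
  define e where "e = (u x - v x) / 2"
  have "0 < e" using \<open>\<not> u x \<le> v x\<close> by (simp add: e_def)
  note u_cont = positive_solution_continuous[OF k g u]
  note v_cont = positive_solution_continuous[OF k g v]
  obtain d1 where d1: "0 < d1" "\<And>y. y \<in> {0..X} \<Longrightarrow> \<bar>y - x\<bar> < d1 \<Longrightarrow> \<bar>u y - u x\<bar> < e"
    using u_cont x \<open>0 < e\<close> unfolding continuous_on_iff dist_real_def by meson
  obtain d2 where d2: "0 < d2" "\<And>y. y \<in> {0..X} \<Longrightarrow> \<bar>y - x\<bar> < d2 \<Longrightarrow> \<bar>v y - v x\<bar> < e"
    using v_cont x \<open>0 < e\<close> unfolding continuous_on_iff dist_real_def by meson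
  define d where "d = min d1 d2 / 2"
  have d: "0 < d" "d < d1" "d < d2" using d1(1) d2(1) by (auto simp: d_def)
  \<comment> \<open>Two points near \<open>x\<close>, one of them \<open>x\<close> itself; at the right end of the interval \<open>x\<close> must be the
    later of the two.\<close>
  obtain a b where ab: "a \<in> {0..X}" "b \<in> {0..X}" "a < b" "\<bar>a - x\<bar> \<le> d" "\<bar>b - x\<bar> \<le> d"
  proof (cases "x < X")
    case True
    then show ?thesis using x d by (intro that[of x "min X (x + d)"]) auto
  next
    case False
    then show ?thesis using x d X by (intro that[of "max 0 (x - d)" x]) auto
  qed
  have "u (b - (b - a)) < v b"
    using ab by (intro shifted_solution_less[OF k(1,2,4) g u u_cont v v_cont]) auto
  moreover have "\<bar>u a - u x\<bar> < e" "\<bar>v b - v x\<bar> < e"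
    using ab d by (auto intro!: d1(2) d2(2))
  ultimately show False by (auto simp: e_def field_simps abs_if split: if_splits)
qed

theorem theorem8:
  fixes k :: "real \<Rightarrow> real \<Rightarrow> real" and g :: "real \<Rightarrow> real"
    and X :: real and u v :: "real \<Rightarrow> real"
  assumes "general_conditions k g" and "K3 k" and "K4 k"
    and "0 < X"
    and "positive_solution k g X u" and "positive_solution k g X v"
  shows "\<forall>x\<in>{0..X}. u x = v x"
  using assms positive_solution_le[of k g X] unfolding general_conditions_def
  by (meson order_antisym)

end
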